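(* Let $\alpha\in(0,1)$, $\sigma=1-\alpha/2$, $T>0$; let $\lambda\in\mathcal{C}^2[0,T]$ with $\lambda(t)>0$, $\lambda'(t)\le0$ on $[0,T]$; let $k=k(t)$, $q=q(t)$ be functions on $[0,T]$ with $0<c_1\le k(t)\le c_2$ and $q(t)\ge0$; let $f$ be a function on $[0,1]\times[0,T]$ and $u_0$ a function on $[0,1]$. Let $h=1/N$, $\tau=T/M$ with $N\geq 2$, $M\ge1$ integers, $x_i=ih$, $t_j=j\tau$. Consider the compact difference scheme $$\Delta_{0t_{j+\sigma}}^{\alpha,\lambda(t)}\mathcal{H}_hy_i=a^{j+\sigma}y_{\bar xx,i}^{(\sigma)}-d^{j+\sigma}\mathcal{H}_hy_i^{(\sigma)}+\mathcal{H}_h\varphi_i^{j+\sigma},\quad i=1,\dots,N-1,\ j=0,\dots,M-1,$$ $$y_0^j=y_N^j=0\ (0\le j\le M),\qquad y_i^0=u_0(x_i)\ (0\le i\le N),$$ with all notation defined in the context. This scheme is unconditionally stable: for all such $N$ and $M$ (with no restriction relating $h$ and $\tau$) its solution satisfies, for every $j=0,1,\dots,M-1$, the a priori estimate $$\|\mathcal{H}_hy^{j+1}\|_0^2\le\|\mathcal{H}_hy^0\|_0^2+\frac{T^\alpha\,\Gamma(1-\alpha)}{\lambda(T)c_1}\max_{0\le m\le M-1}\|\mathcal{H}_h\varphi^{m+\sigma}\|_0^2 .$$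
   Context: Notation: $y_i^j=y(x_i,t_j)$, $t_{j+\sigma}=(j+\sigma)\tau$, $y^{(\sigma)}=\sigma y^{j+1}+(1-\sigma)y^j$, $v_{\bar xx,i}=(v_{i+1}-2v_i+v_{i-1})/h^2$, $\mathcal{H}_hv_i=v_i+\frac{h^2}{12}v_{\bar xx,i}$ for $i=1,\dots,N-1$, $a^{j+\sigma}=k(t_{j+\sigma})$, $d^{j+\sigma}=q(t_{j+\sigma})$, $\varphi_i^{j+\sigma}=f(x_i,t_{j+\sigma})$ ($0\le i\le N$), $\|v\|_0^2=\sum_{i=1}^{N-1}v_i^2h$. The discrete fractional derivative is $$\Delta_{0t_{j+\sigma}}^{\alpha,\lambda(t)}y_i=\frac{\tau^{1-\alpha}}{\Gamma(2-\alpha)}\sum_{s=0}^{j}c_{j-s}^{(\alpha)}\,\frac{y_i^{s+1}-y_i^s}{\tau}.$$ Its coefficients are as follows. Write $\lambda_s=\lambda(s\tau)$ for real $s$, $$a_0^{(\alpha)}=\sigma^{1-\alpha},\qquad a_l^{(\alpha)}=(l+\sigma)^{1-\alpha}-(l-1+\sigma)^{1-\alpha}\quad(l\ge1),$$ $$b_l^{(\alpha)}=\tfrac{1}{2-\alpha}\left[(l+\sigma)^{2-\alpha}-(l-1+\sigma)^{2-\alpha}\right]-\tfrac12\left[(l+\sigma)^{1-\alpha}+(l-1+\sigma)^{1-\alpha}\right]\quad(l\ge1).$$ For $j=0$: $c_0^{(\alpha)}=\lambda_{\sigma-1/2}a_0^{(\alpha)}$. For $j\ge1$: $$c_s^{(\alpha)}=\begin{cases}\lambda_{\sigma-1/2}a_0^{(\alpha)}+\lambda_\sigma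 b_1^{(\alpha)}, & s=0,\\ \lambda_{s+\sigma-1/2}a_s^{(\alpha)}+\lambda_{s+\sigma}b_{s+1}^{(\alpha)}-\lambda_{s+\sigma}b_s^{(\alpha)}, & 1\le s\le j-1,\\ \lambda_{j+\sigma-1/2}a_j^{(\alpha)}-\lambda_{j+\sigma}b_j^{(\alpha)}, & s=j.\end{cases}$$ *)

theory Defs
  imports "HOL-Analysis.Analysis"
begin

text \<open>
  A grid function in space is a map \<open>nat \<Rightarrow> real\<close>, \<open>i \<mapsto> v\<^sub>i\<close>; a space-time grid function is
  \<open>y i j\<close> with spatial index \<open>i\<close> first and time level \<open>j\<close> second.  Only the values at
  \<open>0 \<le> i \<le> N\<close> and \<open>0 \<le> j \<le> M\<close> are ever relevant.
\<close>

definition second_diff :: "real \<Rightarrow> (nat \<Rightarrow> real) \<Rightarrow> nat \<Rightarrow> real" where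
  "second_diff h v i = (v (i + 1) - 2 * v i + v (i - 1)) / h\<^sup>2"

definition compact_op :: "real \<Rightarrow> (nat \<Rightarrow> real) \<Rightarrow> nat \<Rightarrow> real" where
  "compact_op h v i = v i + h\<^sup>2 / 12 * second_diff h v i"

definition norm0 :: "nat \<Rightarrow> real \<Rightarrow> (nat \<Rightarrow> real) \<Rightarrow> real" where
  "norm0 N h v = sqrt (\<Sum>i=1..N-1. (v i)\<^sup>2 * h)"

definition coeff_a :: "real \<Rightarrow> real \<Rightarrow> nat \<Rightarrow> real" where
  "coeff_a \<alpha> \<sigma> l =
    (if l = 0 then \<sigma> powr (1 - \<alpha>)
     else (real l + \<sigma>) powr (1 - \<alpha>) - (real l - 1 + \<sigma>) powr (1 - \<alpha>))"

text \<open>\<open>coeff_b\<close> is only meaningful, and only used, for \<open>l \<ge> 1\<close>.\<close>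

definition coeff_b :: "real \<Rightarrow> real \<Rightarrow> nat \<Rightarrow> real" where
  "coeff_b \<alpha> \<sigma> l =
    1 / (2 - \<alpha>) * ((real l + \<sigma>) powr (2 - \<alpha>) - (real l - 1 + \<sigma>) powr (2 - \<alpha>))
    - 1 / 2 * ((real l + \<sigma>) powr (1 - \<alpha>) + (real l - 1 + \<sigma>) powr (1 - \<alpha>))"

text \<open>
  The coefficient \<open>c\<^sub>s\<close>, \<open>0 \<le> s \<le> j\<close>, belonging to the time level \<open>j\<close>.
  In the statement, \<open>\<lambda>\<^sub>s\<close> with a (possibly fractional) index stands for \<open>\<lambda>(s\<tau>)\<close>.
\<close>

definition coeff_c ::
    "real \<Rightarrow> real \<Rightarrow> (real \<Rightarrow> real) \<Rightarrow> real \<Rightarrow> nat \<Rightarrow> nat \<Rightarrow> real" where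
  "coeff_c \<alpha> \<sigma> lam \<tau> j s =
    (let L = (\<lambda>r. lam (r * \<tau>)); a = coeff_a \<alpha> \<sigma>; b = coeff_b \<alpha> \<sigma> in
     if j = 0 then L (\<sigma> - 1/2) * a 0
     else if s = 0 then L (\<sigma> - 1/2) * a 0 + L \<sigma> * b 1
     else if s < j then
       L (real s + \<sigma> - 1/2) * a s + L (real s + \<sigma>) * b (s + 1) - L (real s + \<sigma>) * b s
     else L (real j + \<sigma> - 1/2) * a j - L (real j + \<sigma>) * b j)"

text \<open>The discrete fractional derivative at \<open>t\<^bsub>j+\<sigma>\<^esub>\<close> of a grid function \<open>w\<close> of the time level.\<close>

definition discrete_frac_deriv ::
    "real \<Rightarrow> real \<Rightarrow> (real \<Rightarrow> real) \<Rightarrow> real \<Rightarrow> nat \<Rightarrow> (nat \<Rightarrow> real) \<Rightarrow> real" where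
  "discrete_frac_deriv \<alpha> \<sigma> lam \<tau> j w =
    \<tau> powr (1 - \<alpha>) / Gamma (2 - \<alpha>) *
      (\<Sum>s=0..j. coeff_c \<alpha> \<sigma> lam \<tau> j (j - s) * ((w (s + 1) - w s) / \<tau>))"

definition weighted :: "real \<Rightarrow> (nat \<Rightarrow> nat \<Rightarrow> real) \<Rightarrow> nat \<Rightarrow> nat \<Rightarrow> real" where
  "weighted \<sigma> y j i = \<sigma> * y i (j + 1) + (1 - \<sigma>) * y i j"

text \<open>The grid function \<open>i \<mapsto> f(x\<^sub>i, t\<^bsub>j+\<sigma>\<^esub>)\<close>.\<close>

definition source_grid ::
    "(real \<Rightarrow> real \<Rightarrow> real) \<Rightarrow> real \<Rightarrow> real \<Rightarrow> real \<Rightarrow> nat \<Rightarrow> nat \<Rightarrow> real" where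
  "source_grid f \<sigma> h \<tau> j i = f (real i * h) ((real j + \<sigma>) * \<tau>)"

definition solves_compact_scheme ::
    "real \<Rightarrow> real \<Rightarrow> (real \<Rightarrow> real) \<Rightarrow> (real \<Rightarrow> real) \<Rightarrow> (real \<Rightarrow> real) \<Rightarrow>
     (real \<Rightarrow> real \<Rightarrow> real) \<Rightarrow> (real \<Rightarrow> real) \<Rightarrow> nat \<Rightarrow> nat \<Rightarrow> real \<Rightarrow> real \<Rightarrow>
     (nat \<Rightarrow> nat \<Rightarrow> real) \<Rightarrow> bool" where
  "solves_compact_scheme \<alpha> \<sigma> lam k q f u0 N M h \<tau> y \<longleftrightarrow>
    (\<forall>i\<in>{1..N-1}. \<forall>j<M.
       discrete_frac_deriv \<alpha> \<sigma> lam \<tau> j (\<lambda>n. compact_op h (\<lambda>l. y l n) i) =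
         k ((real j + \<sigma>) * \<tau>) * second_diff h (weighted \<sigma> y j) i
         - q ((real j + \<sigma>) * \<tau>) * compact_op h (weighted \<sigma> y j) i
         + compact_op h (source_grid f \<sigma> h \<tau> j) i) \<and>
    (\<forall>j\<le>M. y 0 j = 0 \<and> y N j = 0) \<and>
    (\<forall>i\<le>N. y i 0 = u0 (real i * h))"

end

theory Submission
  imports Defs
begin

text \<open>
  Since \<open>\<lambda>\<close> is positive and nonincreasing, the coefficients \<open>c\<^sub>s\<close> decrease in \<open>s\<close>, satisfy
  \<open>(2\<sigma> - 1) c\<^sub>0 \<ge> \<sigma> c\<^sub>1\<close>, and are bounded below by \<open>\<lambda>(T) (1 - \<alpha>)/2 (j + \<sigma>)\<^bsup>-\<alpha>\<^esup>\<close>; everything reduces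
  to convexity properties of powers of \<open>x\<close>.  The first two properties give Alikhanov's inequality
  \<open>w\<^sup>(\<^sup>\<sigma>\<^sup>) \<Delta>w \<ge> \<Delta>(w\<^sup>2)/2\<close>.  Testing the scheme with \<open>\<H>\<^sub>h y\<^sup>(\<^sup>\<sigma>\<^sup>)\<close>, using
  \<open>-(v\<^sub>x\<^sub>x, \<H>\<^sub>h v) \<ge> \<parallel>\<H>\<^sub>h v\<parallel>\<^sup>2\<close> to absorb the source by Young's inequality, bounds
  \<open>\<Delta>\<parallel>\<H>\<^sub>h y\<parallel>\<^sup>2\<close> by \<open>\<parallel>\<H>\<^sub>h \<phi>\<parallel>\<^sup>2 / (2 c\<^sub>1)\<close>, where \<open>c\<^sub>1\<close> now is the lower bound of \<open>k\<close>.  By monotonicity of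
  the coefficients this bound is propagated from one time level to the next.
\<close>

subsection \<open>Coefficients\<close>

text \<open>The error of the trapezoidal rule on \<open>[x, x + 1]\<close> for
  \<open>z powr (1 - \<alpha>)\<close>: integral minus trapezoid. A real argument in place of
  \<open>l - 1 + \<sigma>\<close> allows differentiation.\<close>

definition trapezoid_gap :: "real \<Rightarrow> real \<Rightarrow> real" where
  "trapezoid_gap \<alpha> x = ((x + 1) powr (2 - \<alpha>) - x powr (2 - \<alpha>)) / (2 - \<alpha>)
    - (x powr (1 - \<alpha>) + (x + 1) powr (1 - \<alpha>)) / 2"

lemma coeff_a_Suc:
  "coeff_a \<alpha> \<sigma> (Suc l) = (real l + \<sigma> + 1) powr (1 - \<alpha>) - (real l + \<sigma>) powr (1 - \<alpha>)"
  by (simp add: coeff_a_def algebra_simps)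

lemma coeff_b_Suc: "coeff_b \<alpha> \<sigma> (Suc l) = trapezoid_gap \<alpha> (real l + \<sigma>)"
  by (simp add: coeff_b_def trapezoid_gap_def add_divide_distrib diff_divide_distrib algebra_simps)

text \<open>The upper Hermite-Hadamard inequality, with an antiderivative in place of the integral:
  \<open>p\<close> lies below its chord, so \<open>F\<close> minus an antiderivative of the chord is
  nonincreasing.\<close>

lemma increment_le_trapezoid_of_convex:
  fixes F p :: "real \<Rightarrow> real"
  assumes "convex_on {x..x + 1} p"
    and deriv: "\<And>t. x \<le> t \<Longrightarrow> t \<le> x + 1 \<Longrightarrow> (F has_real_derivative p t) (at t)"
  shows "F (x + 1) - F x \<le> (p x + p (x + 1)) / 2"
proof -
  define \<phi> where "\<phi> t = F (x + t) - t * p x - t\<^sup>2 / 2 * (p (x + 1) - p x)" for t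
  have "\<phi> 1 \<le> \<phi> 0"
  proof (rule DERIV_nonpos_imp_nonincreasing[where f = \<phi>])
    fix t :: real
    assume t: "0 \<le> t" "t \<le> 1"
    have F: "(F has_real_derivative p (x + t)) (at (x + t))"
      using deriv t by simp
    have "((\<lambda>t. F (x + t)) has_real_derivative p (x + t)) (at t)"
      using DERIV_shift[of F "p (x + t)" t x] F by (simp add: add.commute)
    then have "(\<phi> has_real_derivative p (x + t) - p x - t * (p (x + 1) - p x)) (at t)"
      unfolding \<phi>_def by (auto intro!: derivative_eq_intros)
    moreover have "p ((1 - t) *\<^sub>R x + t *\<^sub>R (x + 1)) \<le> (1 - t) * p x + t * p (x + 1)"
      using assms(1) t by (intro convex_onD) auto
    then have "p (x + t) - p x - t * (p (x + 1) - p x) \<le> 0"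
      by (simp add: algebra_simps)
    ultimately show "\<exists>d. (\<phi> has_real_derivative d) (at t) \<and> d \<le> 0"
      by blast
  qed simp
  then show ?thesis
    by (simp add: \<phi>_def field_simps)
qed

lemma convex_on_powr_nonpos_exponent:
  fixes p :: real
  assumes "p \<le> 0" "A \<subseteq> {0<..}" "convex A"
  shows "convex_on A (\<lambda>x. x powr p)"
proof (rule f''_ge0_imp_convex[where f' = "\<lambda>x. p * x powr (p - 1)"
      and f'' = "\<lambda>x. p * ((p - 1) * x powr (p - 2))"])
  fix x assume "x \<in> A"
  then have "x > 0" using assms by auto
  show "((\<lambda>x. x powr p) has_real_derivative p * x powr (p - 1)) (at x)"
    using \<open>x > 0\<close> by (auto intro!: derivative_eq_intros)
  show "((\<lambda>x. p * x powr (p - 1)) has_real_derivative p * ((p - 1) * x powr (p - 2))) (at x)"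
    using \<open>x > 0\<close> by (auto intro!: derivative_eq_intros)
  show "0 \<le> p * ((p - 1) * x powr (p - 2))"
    using assms(1) by (intro mult_nonpos_nonpos mult_nonpos_nonneg) auto
qed (use assms in auto)

lemma convex_on_minus_powr:
  fixes p :: real
  assumes "0 \<le> p" "p \<le> 1" "A \<subseteq> {0<..}" "convex A"
  shows "convex_on A (\<lambda>x. - (x powr p))"
proof (rule f''_ge0_imp_convex[where f' = "\<lambda>x. - (p * x powr (p - 1))"
      and f'' = "\<lambda>x. - (p * ((p - 1) * x powr (p - 2)))"])
  fix x assume "x \<in> A"
  then have "x > 0" using assms by auto
  show "((\<lambda>x. - (x powr p)) has_real_derivative - (p * x powr (p - 1))) (at x)"
    using \<open>x > 0\<close> by (auto intro!: derivative_eq_intros)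
  show "((\<lambda>x. - (p * x powr (p - 1))) has_real_derivative - (p * ((p - 1) * x powr (p - 2)))) (at x)"
    using \<open>x > 0\<close> by (auto intro!: derivative_eq_intros)
  have "p * (p - 1) \<le> 0" using assms by (simp add: mult_le_0_iff)
  then show "0 \<le> - (p * ((p - 1) * x powr (p - 2)))"
    using mult_right_mono[of "p * (p - 1)" 0 "x powr (p - 2)"] by (simp add: mult.assoc)
qed (use assms in auto)

section \<open>Increments and trapezoidal errors of powers\<close>

context
  fixes \<alpha> :: real
  assumes \<alpha>: "0 < \<alpha>" "\<alpha> < 1"
begin

text \<open>Mean value theorem: the derivative \<open>(1 - \<alpha>) * z powr - \<alpha>\<close>
  decreases in \<open>z\<close>.\<close>

lemma powr_increment_bounds:
  assumes "x > 0"
  shows "(x + 1) powr (1 - \<alpha>) - x powr (1 - \<alpha>) \<le> (1 - \<alpha>) * x powr - \<alpha>"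
    and "(1 - \<alpha>) * (x + 1) powr - \<alpha> \<le> (x + 1) powr (1 - \<alpha>) - x powr (1 - \<alpha>)"
proof -
  have "\<exists>z. x < z \<and> z < x + 1 \<and> (x + 1) powr (1 - \<alpha>) - x powr (1 - \<alpha>)
      = (x + 1 - x) * ((1 - \<alpha>) * z powr - \<alpha>)"
    by (rule MVT2) (use assms in \<open>auto intro!: derivative_eq_intros\<close>)
  then obtain z where z: "x < z" "z < x + 1"
    "(x + 1) powr (1 - \<alpha>) - x powr (1 - \<alpha>) = (1 - \<alpha>) * z powr - \<alpha>"
    by auto
  have "z powr - \<alpha> \<le> x powr - \<alpha>" "(x + 1) powr - \<alpha> \<le> z powr - \<alpha>"
    using z assms \<alpha> by (auto intro!: powr_mono2')
  then show "(x + 1) powr (1 - \<alpha>) - x powr (1 - \<alpha>) \<le> (1 - \<alpha>) * x powr - \<alpha>"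
    "(1 - \<alpha>) * (x + 1) powr - \<alpha> \<le> (x + 1) powr (1 - \<alpha>) - x powr (1 - \<alpha>)"
    using z(3) \<alpha> by auto
qed

lemma powr_2_increment_le:
  assumes "x > 0"
  shows "((x + 1) powr (2 - \<alpha>) - x powr (2 - \<alpha>)) / (2 - \<alpha>) \<le> (x + 1) powr (1 - \<alpha>)"
proof -
  have "\<exists>z. x < z \<and> z < x + 1 \<and> (x + 1) powr (2 - \<alpha>) - x powr (2 - \<alpha>)
      = (x + 1 - x) * ((2 - \<alpha>) * z powr (1 - \<alpha>))"
    by (rule MVT2) (use assms in \<open>auto intro!: derivative_eq_intros\<close>)
  then obtain z where z: "x < z" "z < x + 1"
    "(x + 1) powr (2 - \<alpha>) - x powr (2 - \<alpha>) = (2 - \<alpha>) * z powr (1 - \<alpha>)"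
    by auto
  have "z powr (1 - \<alpha>) \<le> (x + 1) powr (1 - \<alpha>)"
    using z assms \<alpha> by (intro powr_mono2) auto
  then show ?thesis
    using z(3) \<alpha> by simp
qed

text \<open>The integrand \<open>z powr (1 - \<alpha>)\<close> is concave, so the trapezoid lies
  below the integral; the convex case is applied to the negatives.\<close>

lemma trapezoid_gap_nonneg:
  assumes "x > 0"
  shows "0 \<le> trapezoid_gap \<alpha> x"
proof -
  have "- ((x + 1) powr (2 - \<alpha>) / (2 - \<alpha>)) - - (x powr (2 - \<alpha>) / (2 - \<alpha>))
      \<le> (- (x powr (1 - \<alpha>)) + - ((x + 1) powr (1 - \<alpha>))) / 2"
    using assms \<alpha>
    by (intro increment_le_trapezoid_of_convex convex_on_minus_powr)
      (auto intro!: derivative_eq_intros)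
  then show ?thesis
    by (simp add: trapezoid_gap_def diff_divide_distrib add_divide_distrib)
qed

lemma has_real_derivative_trapezoid_gap:
  assumes "x > 0"
  shows "(trapezoid_gap \<alpha> has_real_derivative
    (x + 1) powr (1 - \<alpha>) - x powr (1 - \<alpha>)
      - ((1 - \<alpha>) * x powr - \<alpha> + (1 - \<alpha>) * (x + 1) powr - \<alpha>) / 2) (at x)"
proof -
  have integral: "((\<lambda>x. ((x + 1) powr (2 - \<alpha>) - x powr (2 - \<alpha>)) / (2 - \<alpha>)) has_real_derivative
      ((2 - \<alpha>) * (x + 1) powr (1 - \<alpha>) - (2 - \<alpha>) * x powr (1 - \<alpha>)) / (2 - \<alpha>)) (at x)"
    by (intro DERIV_cdivide) (use assms in \<open>auto intro!: derivative_eq_intros\<close>)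
  have cancel: "((2 - \<alpha>) * (x + 1) powr (1 - \<alpha>) - (2 - \<alpha>) * x powr (1 - \<alpha>)) / (2 - \<alpha>)
      = (x + 1) powr (1 - \<alpha>) - x powr (1 - \<alpha>)"
    using \<alpha> by (simp add: diff_divide_distrib)
  have average: "((\<lambda>x. (x powr (1 - \<alpha>) + (x + 1) powr (1 - \<alpha>)) / 2) has_real_derivative
      ((1 - \<alpha>) * x powr - \<alpha> + (1 - \<alpha>) * (x + 1) powr - \<alpha>) / 2) (at x)"
    by (intro DERIV_cdivide) (use assms in \<open>auto intro!: derivative_eq_intros\<close>)
  show ?thesis
    unfolding trapezoid_gap_def by (rule DERIV_diff[OF integral[unfolded cancel] average])
qed

text \<open>The derivative of the gap is the trapezoidal error of the convex function
  \<open>(1 - \<alpha>) * z powr - \<alpha>\<close>, hence nonpositive.\<close>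

lemma trapezoid_gap_decreasing:
  assumes "x > 0"
  shows "trapezoid_gap \<alpha> (x + 1) \<le> trapezoid_gap \<alpha> x"
proof (rule DERIV_nonpos_imp_nonincreasing[where f = "trapezoid_gap \<alpha>"])
  fix t assume "x \<le> t" "t \<le> x + 1"
  then have t: "t > 0" using assms by simp
  have "convex_on {t..t + 1} (\<lambda>x. (1 - \<alpha>) * x powr - \<alpha>)"
    using t \<alpha> by (intro convex_on_cmul convex_on_powr_nonpos_exponent) auto
  then have "(t + 1) powr (1 - \<alpha>) - t powr (1 - \<alpha>)
      \<le> ((1 - \<alpha>) * t powr - \<alpha> + (1 - \<alpha>) * (t + 1) powr - \<alpha>) / 2"
    by (rule increment_le_trapezoid_of_convex)
      (use t in \<open>auto intro!: derivative_eq_intros\<close>)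
  then show "\<exists>d. (trapezoid_gap \<alpha> has_real_derivative d) (at t) \<and> d \<le> 0"
    using has_real_derivative_trapezoid_gap[OF t] by auto
qed simp

text \<open>The quantity is \<open>coeff_a - coeff_b\<close> at one index \<open>l \<ge> 1\<close>,
  with \<open>x = l - 1 + \<sigma>\<close>; its decrease drives that of
  \<open>coeff_c\<close>.\<close>

lemma increment_minus_gap_decreasing:
  assumes "x > 0"
  shows "(x + 1 + 1) powr (1 - \<alpha>) - (x + 1) powr (1 - \<alpha>) - trapezoid_gap \<alpha> (x + 1)
    \<le> (x + 1) powr (1 - \<alpha>) - x powr (1 - \<alpha>) - trapezoid_gap \<alpha> x"
proof (rule DERIV_nonpos_imp_nonincreasing
    [where f = "\<lambda>x. (x + 1) powr (1 - \<alpha>) - x powr (1 - \<alpha>) - trapezoid_gap \<alpha> x"])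
  fix t assume "x \<le> t" "t \<le> x + 1"
  then have t: "t > 0" using assms by simp
  let ?I = "(t + 1) powr (1 - \<alpha>) - t powr (1 - \<alpha>)"
  let ?p = "(1 - \<alpha>) * t powr - \<alpha>" and ?q = "(1 - \<alpha>) * (t + 1) powr - \<alpha>"
  have "((\<lambda>x. (x + 1) powr (1 - \<alpha>) - x powr (1 - \<alpha>) - trapezoid_gap \<alpha> x)
      has_real_derivative (?q - ?p) - (?I - (?p + ?q) / 2)) (at t)"
    by (intro DERIV_diff has_real_derivative_trapezoid_gap t)
      (use t in \<open>auto intro!: derivative_eq_intros\<close>)
  \<comment> \<open>The left side equals \<open>(3 * ?q - ?p) / 2 - ?I\<close>, and
    \<open>?q \<le> ?I \<le> ?p\<close>.\<close>
  moreover have "(?q - ?p) - (?I - (?p + ?q) / 2) \<le> 0"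
    using powr_increment_bounds[OF t] by argo
  ultimately show "\<exists>d. ((\<lambda>x. (x + 1) powr (1 - \<alpha>) - x powr (1 - \<alpha>) - trapezoid_gap \<alpha> x)
      has_real_derivative d) (at t) \<and> d \<le> 0"
    by blast
qed simp

text \<open>Bounding the integral in the gap by the right endpoint value
  \<open>(x + 1) powr (1 - \<alpha>)\<close> leaves half the increment.\<close>

lemma increment_minus_gap_ge:
  assumes "x > 0"
  shows "(1 - \<alpha>) / 2 * (x + 1) powr - \<alpha>
    \<le> (x + 1) powr (1 - \<alpha>) - x powr (1 - \<alpha>) - trapezoid_gap \<alpha> x"
  using powr_increment_bounds(2)[OF assms] powr_2_increment_le[OF assms]
  unfolding trapezoid_gap_def by argo

section \<open>Lower bound, sign and order of the coefficients at a fixed time level\<close>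

context
  fixes \<sigma> \<tau> T :: real and lam :: "real \<Rightarrow> real" and j :: nat
  assumes \<sigma>: "\<sigma> = 1 - \<alpha> / 2"
    and \<tau>: "\<tau> > 0"
    and lam_pos: "\<And>t. 0 \<le> t \<Longrightarrow> t \<le> T \<Longrightarrow> 0 < lam t"
    and lam_antimono: "\<And>s t. 0 \<le> s \<Longrightarrow> s \<le> t \<Longrightarrow> t \<le> T \<Longrightarrow> lam t \<le> lam s"
    and j: "(real j + \<sigma>) * \<tau> \<le> T"
begin

lemma lam_grid_antimono:
  assumes "0 \<le> r" "r \<le> r'" "r' \<le> real j + \<sigma>"
  shows "lam (r' * \<tau>) \<le> lam (r * \<tau>)"
proof -
  have "r' * \<tau> \<le> (real j + \<sigma>) * \<tau>"
    using assms \<tau> by auto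
  also note j
  finally show ?thesis
    using assms \<tau> by (intro lam_antimono) auto
qed

lemma lam_grid_pos:
  assumes "0 \<le> r" "r \<le> real j + \<sigma>"
  shows "0 < lam (r * \<tau>)"
proof -
  have "r * \<tau> \<le> (real j + \<sigma>) * \<tau>"
    using assms \<tau> by auto
  also note j
  finally show ?thesis
    using assms \<tau> by (intro lam_pos) auto
qed

text \<open>This weight belongs to the oldest difference; its lower bound produces the constant of
  the final estimate. For \<open>j \<ge> 1\<close>, lowering both values of \<open>lam\<close> to
  that at \<open>j + \<sigma>\<close> leaves a multiple of \<open>coeff_a - coeff_b\<close>.\<close>

lemma coeff_c_last_ge:
  "lam T * ((1 - \<alpha>) / 2 * (real j + \<sigma>) powr - \<alpha>) \<le> coeff_c \<alpha> \<sigma> lam \<tau> j j"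
proof -
  let ?P = "(1 - \<alpha>) / 2 * (real j + \<sigma>) powr - \<alpha>"
  have \<sigma>': "1 / 2 < \<sigma>" "\<sigma> < 1" using \<sigma> \<alpha> by auto
  have T: "lam T \<le> lam ((real j + \<sigma>) * \<tau>)"
    using j \<sigma>' \<tau> by (intro lam_antimono) auto
  have P: "0 \<le> ?P" using \<alpha> by simp
  show ?thesis
  proof (cases j)
    case 0
    \<comment> \<open>There is no gap term at \<open>j = 0\<close>;
      \<open>\<sigma> \<ge> (1 - \<alpha>) / 2\<close> suffices.\<close>
    have "?P \<le> \<sigma> powr (1 - \<alpha>)"
    proof -
      have "\<sigma> powr (1 - \<alpha>) = \<sigma> * \<sigma> powr - \<alpha>"
        using \<sigma>' powr_add[of \<sigma> 1 "- \<alpha>"] by simp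
      moreover have "(1 - \<alpha>) / 2 * \<sigma> powr - \<alpha> \<le> \<sigma> * \<sigma> powr - \<alpha>"
        using \<sigma> \<alpha> by (intro mult_right_mono) auto
      ultimately show ?thesis using 0 by simp
    qed
    moreover have "lam T \<le> lam ((\<sigma> - 1 / 2) * \<tau>)"
      using T lam_grid_antimono[of "\<sigma> - 1 / 2" \<sigma>] 0 \<sigma>' by simp
    ultimately have "lam T * ?P \<le> lam ((\<sigma> - 1 / 2) * \<tau>) * \<sigma> powr (1 - \<alpha>)"
      using P lam_grid_pos[of "\<sigma> - 1 / 2"] \<sigma>' by (intro mult_mono) auto
    then show ?thesis
      using 0 by (simp add: coeff_c_def coeff_a_def)
  next
    case (Suc l)
    let ?x = "real l + \<sigma>"
    let ?I = "(?x + 1) powr (1 - \<alpha>) - ?x powr (1 - \<alpha>)"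
    have x: "?x > 0" using \<sigma>' by simp
    have jx: "real j + \<sigma> = ?x + 1" using Suc by simp
    have I: "?P \<le> ?I - trapezoid_gap \<alpha> ?x"
      using increment_minus_gap_ge[OF x] unfolding jx .
    have "lam T * ?P \<le> lam ((?x + 1) * \<tau>) * ?P"
      using T P unfolding jx by (intro mult_right_mono) auto
    also have "\<dots> \<le> lam ((?x + 1) * \<tau>) * (?I - trapezoid_gap \<alpha> ?x)"
      using lam_grid_pos[of "?x + 1"] x jx by (intro mult_left_mono I) simp
    \<comment> \<open>Only the factor of \<open>?I\<close> is raised to the value half a step
      earlier, which needs \<open>?I \<ge> 0\<close>.\<close>
    also have "\<dots> \<le> lam ((?x + 1 - 1 / 2) * \<tau>) * ?I - lam ((?x + 1) * \<tau>) * trapezoid_gap \<alpha> ?x"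
    proof -
      have "0 \<le> ?I" using I P trapezoid_gap_nonneg[OF x] by linarith
      moreover have "lam ((?x + 1) * \<tau>) \<le> lam ((?x + 1 - 1 / 2) * \<tau>)"
        using x jx by (intro lam_grid_antimono) auto
      ultimately have "lam ((?x + 1) * \<tau>) * ?I \<le> lam ((?x + 1 - 1 / 2) * \<tau>) * ?I"
        by (rule mult_right_mono[rotated])
      then show ?thesis by (simp add: right_diff_distrib)
    qed
    also have "\<dots> = coeff_c \<alpha> \<sigma> lam \<tau> j j"
      unfolding coeff_c_def Let_def jx using Suc by (simp add: coeff_a_Suc coeff_b_Suc)
    finally show ?thesis .
  qed
qed

text \<open>As \<open>(1 - \<alpha>) \<sigma>\<^bsup>-\<alpha>\<^esup>\<close> is the slope of \<open>x\<^bsup>1-\<alpha>\<^esup>\<close> at \<open>\<sigma>\<close> and \<open>2\<sigma> - 1 = 1 - \<alpha>\<close>, this is the tangent inequality.\<close>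

lemma coeff_c_1_le:
  assumes "1 \<le> j"
  shows "\<sigma> * coeff_c \<alpha> \<sigma> lam \<tau> j 1 \<le> (2 * \<sigma> - 1) * coeff_c \<alpha> \<sigma> lam \<tau> j 0"
proof -
  have \<sigma>': "1 / 2 < \<sigma>" "\<sigma> < 1" using \<sigma> \<alpha> by auto
  let ?I = "(\<sigma> + 1) powr (1 - \<alpha>) - \<sigma> powr (1 - \<alpha>)"
  let ?b1 = "trapezoid_gap \<alpha> \<sigma>" and ?b2 = "trapezoid_gap \<alpha> (\<sigma> + 1)"
  let ?A = "lam ((\<sigma> - 1 / 2) * \<tau>)" and ?B = "lam (\<sigma> * \<tau>)"
  let ?C = "lam ((\<sigma> + 1 / 2) * \<tau>)" and ?D = "lam ((\<sigma> + 1) * \<tau>)"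
  have pos: "0 < ?A" "0 < ?B" "0 < ?C" "0 < ?D" "?C \<le> ?A"
    using \<sigma>' assms by (auto intro!: lam_grid_pos lam_grid_antimono)
  have b: "0 \<le> ?b1" "?b2 \<le> ?b1"
    using trapezoid_gap_nonneg trapezoid_gap_decreasing \<sigma>' by auto
  have I: "0 \<le> ?I" using \<sigma>' \<alpha> by (auto intro!: powr_mono2)
  have a1: "coeff_a \<alpha> \<sigma> 1 = ?I" "coeff_b \<alpha> \<sigma> 1 = ?b1" "coeff_b \<alpha> \<sigma> 2 = ?b2"
    using coeff_a_Suc[of \<alpha> \<sigma> 0] coeff_b_Suc[of \<alpha> \<sigma> 0] coeff_b_Suc[of \<alpha> \<sigma> 1]
    by (auto simp: add.commute numeral_2_eq_2)
  \<comment> \<open>The gap terms are \<open>- ?D * ?b1\<close> or \<open>?D * (?b2 - ?b1)\<close>,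
    depending on whether 1 is the last index; both are nonpositive.\<close>
  have c1: "coeff_c \<alpha> \<sigma> lam \<tau> j 1 \<le> ?C * ?I"
  proof (cases "j = 1")
    case True
    then have "coeff_c \<alpha> \<sigma> lam \<tau> j 1 = ?C * ?I - ?D * ?b1"
      using a1 by (simp add: coeff_c_def Let_def add.commute)
    then show ?thesis using pos b by simp
  next
    case False
    then have "coeff_c \<alpha> \<sigma> lam \<tau> j 1 = ?C * ?I + ?D * ?b2 - ?D * ?b1"
      using a1 assms by (simp add: coeff_c_def Let_def add.commute numeral_2_eq_2)
    then show ?thesis using pos b by simp
  qed
  have c0: "?A * \<sigma> powr (1 - \<alpha>) \<le> coeff_c \<alpha> \<sigma> lam \<tau> j 0"
    using a1 assms pos b by (simp add: coeff_c_def Let_def coeff_a_def)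
  have "\<sigma> * coeff_c \<alpha> \<sigma> lam \<tau> j 1 \<le> \<sigma> * (?C * ?I)"
    using c1 \<sigma>' by simp
  also have "\<dots> \<le> \<sigma> * (?A * ((1 - \<alpha>) * \<sigma> powr - \<alpha>))"
    using pos I powr_increment_bounds(1)[of \<sigma>] \<sigma>' by (intro mult_left_mono mult_mono) auto
  also have "\<dots> = (2 * \<sigma> - 1) * (?A * \<sigma> powr (1 - \<alpha>))"
  proof -
    have "\<sigma> powr (1 - \<alpha>) = \<sigma> * \<sigma> powr - \<alpha>"
      using \<sigma>' powr_add[of \<sigma> 1 "- \<alpha>"] by simp
    then show ?thesis using \<sigma> by simp
  qed
  also have "\<dots> \<le> (2 * \<sigma> - 1) * coeff_c \<alpha> \<sigma> lam \<tau> j 0"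
    using c0 \<sigma>' by (intro mult_left_mono) auto
  finally show ?thesis .
qed

lemma coeff_c_0_pos: "0 < coeff_c \<alpha> \<sigma> lam \<tau> j 0"
proof -
  have \<sigma>': "1 / 2 < \<sigma>" "\<sigma> < 1" using \<sigma> \<alpha> by auto
  have "0 < lam ((\<sigma> - 1 / 2) * \<tau>)" "0 < lam (\<sigma> * \<tau>)"
    using \<sigma>' by (auto intro!: lam_grid_pos)
  moreover have "0 \<le> coeff_b \<alpha> \<sigma> 1"
    using coeff_b_Suc[of \<alpha> \<sigma> 0] trapezoid_gap_nonneg[of \<sigma>] \<sigma>' by simp
  moreover have "0 < coeff_a \<alpha> \<sigma> 0" using \<sigma>' by (simp add: coeff_a_def)
  ultimately show ?thesis
    by (simp add: coeff_c_def Let_def add_pos_nonneg)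
qed

text \<open>From 0 to 1 it follows from the sharper \<open>coeff_c_1_le\<close>, as
  \<open>2 * \<sigma> - 1 \<le> \<sigma>\<close>. Later indices combine the decrease of
  \<open>lam\<close> with that of increment minus gap.\<close>

lemma coeff_c_Suc_le:
  assumes "Suc s \<le> j"
  shows "coeff_c \<alpha> \<sigma> lam \<tau> j (Suc s) \<le> coeff_c \<alpha> \<sigma> lam \<tau> j s"
proof (cases s)
  case 0
  have \<sigma>': "1 / 2 < \<sigma>" "\<sigma> < 1" using \<sigma> \<alpha> by auto
  have "\<sigma> * coeff_c \<alpha> \<sigma> lam \<tau> j 1 \<le> (2 * \<sigma> - 1) * coeff_c \<alpha> \<sigma> lam \<tau> j 0"
    using assms by (intro coeff_c_1_le) simp
  also have "\<dots> \<le> \<sigma> * coeff_c \<alpha> \<sigma> lam \<tau> j 0"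
    using \<sigma>' coeff_c_0_pos by (intro mult_right_mono) auto
  finally show ?thesis using \<sigma>' 0 by simp
next
  case (Suc l)
  have \<sigma>': "1 / 2 < \<sigma>" "\<sigma> < 1" using \<sigma> \<alpha> by auto
  \<comment> \<open>Here \<open>x = s - 1 + \<sigma>\<close>: \<open>lam\<close> enters the
    \<open>s\<close>-th coefficient at \<open>x + 1/2\<close> and \<open>x + 1\<close>, the next one
    at \<open>x + 3/2\<close> and \<open>x + 2\<close>.\<close>
  define x where "x = real l + \<sigma>"
  have x: "x > 0" "x + 1 > 0" using \<sigma>' by (auto simp: x_def)
  have xj: "x + 2 \<le> real j + \<sigma>" using assms Suc by (simp add: x_def)
  define b where "b = trapezoid_gap \<alpha>"
  define I where "I z = (z + 1) powr (1 - \<alpha>) - z powr (1 - \<alpha>)" for z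
  let ?A = "lam ((x + 1 / 2) * \<tau>)" and ?B = "lam ((x + 1) * \<tau>)"
  let ?C = "lam ((x + 3 / 2) * \<tau>)" and ?D = "lam ((x + 2) * \<tau>)"
  have ord: "0 < ?B" "0 < ?C" "0 < ?D" "?B \<le> ?A" "?C \<le> ?B"
    using x xj by (auto intro!: lam_grid_pos lam_grid_antimono)
  have bb: "0 \<le> b x" "0 \<le> b (x + 1)" "b (x + 2) \<le> b (x + 1)"
    using trapezoid_gap_nonneg x trapezoid_gap_decreasing[of "x + 1"]
    by (auto simp: b_def add.commute)
  have II: "I (x + 1) - b (x + 1) \<le> I x - b x"
    using increment_minus_gap_decreasing[OF x(1)] by (simp add: I_def b_def)
  have Ib: "0 \<le> I x - b x"
    unfolding I_def b_def using \<alpha>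
    by (intro order_trans[OF _ increment_minus_gap_ge[OF x(1)]]) simp
  have cs: "coeff_c \<alpha> \<sigma> lam \<tau> j s = ?A * I x + ?B * b (x + 1) - ?B * b x"
  proof -
    have e: "real s + \<sigma> = x + 1" "real s + \<sigma> - 1 / 2 = x + 1 / 2"
      using Suc by (auto simp: x_def)
    have "coeff_a \<alpha> \<sigma> s = I x" "coeff_b \<alpha> \<sigma> s = b x" "coeff_b \<alpha> \<sigma> (s + 1) = b (x + 1)"
      using coeff_a_Suc[of \<alpha> \<sigma> l] coeff_b_Suc[of \<alpha> \<sigma> l] coeff_b_Suc[of \<alpha> \<sigma> s] Suc
      unfolding e by (simp_all add: I_def b_def x_def)
    then show ?thesis using assms Suc unfolding coeff_c_def Let_def e by (simp add: add.commute)
  qed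
  have cs': "coeff_c \<alpha> \<sigma> lam \<tau> j (Suc s) \<le> ?C * I (x + 1)"
  proof -
    have e: "real (Suc s) + \<sigma> = x + 2" "real (Suc s) + \<sigma> - 1 / 2 = x + 3 / 2"
      "real s + \<sigma> = x + 1" "real (s + 1) + \<sigma> = x + 2" using Suc by (auto simp: x_def)
    have f: "coeff_a \<alpha> \<sigma> (Suc s) = I (x + 1)" "coeff_b \<alpha> \<sigma> (Suc s) = b (x + 1)"
      "coeff_b \<alpha> \<sigma> (Suc s + 1) = b (x + 2)"
      using coeff_a_Suc[of \<alpha> \<sigma> s] coeff_b_Suc[of \<alpha> \<sigma> s] coeff_b_Suc[of \<alpha> \<sigma> "Suc s"]
      unfolding e by (simp_all add: I_def b_def)
    show ?thesis
    proof (cases "Suc s = j")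
      case True
      then have "coeff_c \<alpha> \<sigma> lam \<tau> j (Suc s) = ?C * I (x + 1) - ?D * b (x + 1)"
        using f unfolding coeff_c_def Let_def True[symmetric] e by (simp add: add.commute)
      then show ?thesis using ord bb by simp
    next
      case False
      then have "coeff_c \<alpha> \<sigma> lam \<tau> j (Suc s) = ?C * I (x + 1) + ?D * b (x + 2) - ?D * b (x + 1)"
        using assms f unfolding coeff_c_def Let_def e by (simp add: add.commute)
      then show ?thesis using ord bb by simp
    qed
  qed
  \<comment> \<open>First the powers are compared with \<open>lam\<close> frozen at
    \<open>?C\<close>; then \<open>?C\<close> is raised to \<open>?B\<close>, and to
    \<open>?A\<close> only in front of \<open>I x\<close>.\<close>
  have "?C * I (x + 1) \<le> ?C * (I x - b x + b (x + 1))"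
    using ord II by (intro mult_left_mono) auto
  also have "\<dots> \<le> ?B * (I x - b x + b (x + 1))"
    using ord Ib bb by (intro mult_right_mono) auto
  also have "\<dots> \<le> ?A * I x + ?B * b (x + 1) - ?B * b x"
  proof -
    have "?B * I x \<le> ?A * I x"
      using ord Ib bb by (intro mult_right_mono) auto
    then show ?thesis by (simp add: algebra_simps)
  qed
  finally show ?thesis using cs cs' by simp
qed

end

end

subsection \<open>Sums with monotone weights\<close>

lemma sum_by_parts:
  fixes k E :: "nat \<Rightarrow> real"
  shows "(\<Sum>s=0..j. k s * (E (s + 1) - E s))
    = k j * E (j + 1) - k 0 * E 0 - (\<Sum>s<j. (k (Suc s) - k s) * E (Suc s))"
  by (induction j) (simp_all add: algebra_simps)

text \<open>
  The difference of both sides is the same weighted sum for \<open>E\<^sub>s = (w\<^sub>s - u)\<^sup>2\<close>, \<open>u\<close> being the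
  \<open>\<sigma>\<close>-average; after summation by parts only its last two terms can have the wrong sign.
  The weights are indexed by the time level, so that \<open>k s\<close> stands for \<open>c\<^bsub>j-s\<^esub>\<close>.
\<close>

lemma discrete_energy_inequality:
  fixes k w :: "nat \<Rightarrow> real"
  assumes mono: "\<And>s. s < j \<Longrightarrow> k s \<le> k (Suc s)"
    and "0 \<le> k 0" and \<sigma>: "1 / 2 \<le> \<sigma>" "\<sigma> \<le> 1"
    and last: "1 \<le> j \<Longrightarrow> \<sigma> * k (j - 1) \<le> (2 * \<sigma> - 1) * k j"
  shows "(\<Sum>s=0..j. k s * ((w (s + 1))\<^sup>2 - (w s)\<^sup>2))
    \<le> 2 * (\<Sum>s=0..j. k s * (w (s + 1) - w s)) * (\<sigma> * w (j + 1) + (1 - \<sigma>) * w j)"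
proof -
  define u where "u = \<sigma> * w (j + 1) + (1 - \<sigma>) * w j"
  define E where "E s = (w s - u)\<^sup>2" for s
  define d where "d = w (j + 1) - w j"
  \<comment> \<open>The two newest values deviate from \<open>u\<close> by
    \<open>(1 - \<sigma>) * d\<close> and \<open>- \<sigma> * d\<close>.\<close>
  have E: "E (j + 1) = (1 - \<sigma>)\<^sup>2 * d\<^sup>2" "E j = \<sigma>\<^sup>2 * d\<^sup>2"
    unfolding E_def u_def d_def by (simp_all add: power2_eq_square algebra_simps)
  have "(\<Sum>s=0..j. k s * (E (s + 1) - E s)) \<le> 0"
  proof (cases j)
    case 0
    have "(1 - \<sigma>)\<^sup>2 * d\<^sup>2 \<le> \<sigma>\<^sup>2 * d\<^sup>2"
      using \<sigma> by (intro mult_right_mono power_mono) auto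
    then show ?thesis
      using E 0 assms(2) by (simp add: mult_le_0_iff)
  next
    case (Suc l)
    have kl: "0 \<le> k i" if "i \<le> j" for i
      using that by (induction i) (use assms(2) mono in \<open>auto intro: order_trans\<close>)
    have "0 \<le> (\<Sum>s<l. (k (Suc s) - k s) * E (Suc s))"
      using mono Suc by (intro sum_nonneg mult_nonneg_nonneg) (auto simp: E_def)
    moreover have "0 \<le> k 0 * E 0" using assms(2) by (simp add: E_def)
    moreover have "k j * E (j + 1) \<le> (k j - k l) * E j"
    proof -
      \<comment> \<open>Since \<open>\<sigma>^2 - (1 - \<sigma>)^2 = 2 * \<sigma> - 1\<close>, the
        required inequality amounts to
        \<open>\<sigma>^2 * k l \<le> (2 * \<sigma> - 1) * k j\<close>.\<close>
      have "\<sigma> * (\<sigma> * k l) \<le> \<sigma> * k l"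
        using \<sigma> kl[of l] Suc by (intro mult_left_le_one_le) auto
      also have "\<dots> \<le> (2 * \<sigma> - 1) * k j" using last Suc by simp
      finally have "k j * (1 - \<sigma>)\<^sup>2 \<le> (k j - k l) * \<sigma>\<^sup>2"
        by (simp add: power2_eq_square algebra_simps)
      then have "k j * (1 - \<sigma>)\<^sup>2 * d\<^sup>2 \<le> (k j - k l) * \<sigma>\<^sup>2 * d\<^sup>2"
        by (rule mult_right_mono) simp
      then show ?thesis unfolding E by (simp add: mult.assoc)
    qed
    ultimately show ?thesis
      unfolding sum_by_parts by (simp add: Suc)
  qed
  moreover have "(\<Sum>s=0..j. k s * (E (s + 1) - E s)) =
      (\<Sum>s=0..j. k s * ((w (s + 1))\<^sup>2 - (w s)\<^sup>2)) - 2 * (\<Sum>s=0..j. k s * (w (s + 1) - w s)) * u"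
    unfolding sum_distrib_left sum_distrib_right sum_subtractf[symmetric] E_def
    by (intro sum.cong refl) (simp add: power2_eq_square algebra_simps)
  ultimately show ?thesis
    by (simp add: u_def)
qed

text \<open>For the excess \<open>F\<close> over the bound, \<open>F 0 = - B\<close>, so summation
  by parts cancels \<open>k 0 * B\<close>. What remains bounds \<open>k j * F (j + 1)\<close> by
  nonnegative weight increments times nonpositive earlier excesses.\<close>

lemma discrete_gronwall_step:
  fixes k E :: "nat \<Rightarrow> real"
  assumes mono: "\<And>s. s < j \<Longrightarrow> k s \<le> k (Suc s)" and "0 < k j"
    and le: "(\<Sum>s=0..j. k s * (E (s + 1) - E s)) \<le> k 0 * B"
    and E: "\<And>s. s \<le> j \<Longrightarrow> E s \<le> E 0 + B"
  shows "E (j + 1) \<le> E 0 + B"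
proof -
  define F where "F s = E s - (E 0 + B)" for s
  have "(\<Sum>s=0..j. k s * (E (s + 1) - E s)) = (\<Sum>s=0..j. k s * (F (s + 1) - F s))"
    by (simp add: F_def)
  also have "\<dots> = k j * F (j + 1) + k 0 * B - (\<Sum>s<j. (k (Suc s) - k s) * F (Suc s))"
    unfolding sum_by_parts by (simp add: F_def algebra_simps)
  finally have "k j * F (j + 1) \<le> (\<Sum>s<j. (k (Suc s) - k s) * F (Suc s))"
    using le by simp
  also have "\<dots> \<le> 0"
    using mono E by (intro sum_nonpos mult_nonneg_nonpos) (auto simp: F_def)
  finally show ?thesis
    using assms(2) by (simp add: mult_le_0_iff F_def)
qed

subsection \<open>The compact operator\<close>

text \<open>The compact operator averages with weights 1/12, 10/12, 1/12; convexity of the square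
  applies, and zero boundary values keep the shifted sums below the unshifted one.\<close>

lemma sum_square_compact_le:
  fixes v :: "nat \<Rightarrow> real"
  assumes "v 0 = 0" "v (Suc n) = 0"
  shows "(\<Sum>i<n. ((v i + 10 * v (Suc i) + v (Suc (Suc i))) / 12)\<^sup>2) \<le> (\<Sum>i<n. (v (Suc i))\<^sup>2)"
proof -
  have conv: "((x + 10 * y + z) / 12)\<^sup>2 \<le> (x\<^sup>2 + 10 * y\<^sup>2 + z\<^sup>2) / 12" for x y z :: real
    using sum_squares_bound[of x y] sum_squares_bound[of y z] sum_squares_bound[of x z]
    by (simp add: power2_eq_square algebra_simps divide_simps)
  have "(\<Sum>i<n. ((v i + 10 * v (Suc i) + v (Suc (Suc i))) / 12)\<^sup>2)
      \<le> (\<Sum>i<n. ((v i)\<^sup>2 + 10 * (v (Suc i))\<^sup>2 + (v (Suc (Suc i)))\<^sup>2) / 12)"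
    by (intro sum_mono conv)
  also have "\<dots> = ((\<Sum>i<n. (v i)\<^sup>2) + 10 * (\<Sum>i<n. (v (Suc i))\<^sup>2) + (\<Sum>i<n. (v (Suc (Suc i)))\<^sup>2)) / 12"
    by (simp add: sum.distrib sum_divide_distrib[symmetric] sum_distrib_left)
  also have "\<dots> \<le> (\<Sum>i<n. (v (Suc i))\<^sup>2)"
    using sum.lessThan_Suc_shift[of "\<lambda>i. (v i)\<^sup>2" n] sum.lessThan_Suc_shift[of "\<lambda>i. (v (Suc i))\<^sup>2" n]
      sum.lessThan_Suc[of "\<lambda>i. (v i)\<^sup>2" n] sum.lessThan_Suc[of "\<lambda>i. (v (Suc i))\<^sup>2" n]
      zero_le_power2[of "v n"] zero_le_power2[of "v (Suc 0)"] assms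
    by (simp only: power_zero_numeral) argo
  finally show ?thesis .
qed

text \<open>Telescoping from the zero left end and Cauchy-Schwarz bound each square by
  \<open>(i + 1) * S\<close>; then these factors are summed.\<close>

lemma discrete_poincare:
  fixes v :: "nat \<Rightarrow> real"
  assumes "v 0 = 0"
  shows "(\<Sum>i<n. (v (Suc i))\<^sup>2) \<le> (real n + 1)\<^sup>2 / 2 * (\<Sum>i\<le>n. (v (Suc i) - v i)\<^sup>2)"
proof -
  define S where "S = (\<Sum>i\<le>n. (v (Suc i) - v i)\<^sup>2)"
  have S0: "0 \<le> S" by (auto simp: S_def intro: sum_nonneg)
  have "(v (Suc i))\<^sup>2 \<le> (real i + 1) * S" if "i < n" for i
  proof -
    have "v (Suc i) = (\<Sum>l<Suc i. (v (Suc l) - v l) * 1)"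
      using assms sum_lessThan_telescope[of v "Suc i"] by simp
    then have "(v (Suc i))\<^sup>2 \<le> (\<Sum>l<Suc i. (v (Suc l) - v l)\<^sup>2) * (\<Sum>l<Suc i. 1\<^sup>2)"
      using Cauchy_Schwarz_ineq_sum[of "\<lambda>l. v (Suc l) - v l" "\<lambda>_. 1" "{..<Suc i}"] by metis
    also have "\<dots> \<le> S * (\<Sum>l<Suc i. 1\<^sup>2)"
      unfolding S_def using that by (intro mult_right_mono sum_mono2) auto
    finally show ?thesis by (simp add: algebra_simps)
  qed
  then have "(\<Sum>i<n. (v (Suc i))\<^sup>2) \<le> (\<Sum>i<n. (real i + 1) * S)"
    by (intro sum_mono) auto
  also have "\<dots> = real n * (real n + 1) / 2 * S"
    by (induction n) (auto simp: field_simps)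
  also have "\<dots> \<le> (real n + 1)\<^sup>2 / 2 * S"
    using S0 by (intro mult_right_mono) (auto simp: power2_eq_square algebra_simps)
  finally show ?thesis by (simp add: S_def)
qed

lemma sum_second_difference_times:
  fixes v :: "nat \<Rightarrow> real"
  shows "(\<Sum>i<n. (v (Suc (Suc i)) - 2 * v (Suc i) + v i) * v (Suc i))
    = (v (Suc n) - v n) * v (Suc n) - (v 1 - v 0) * v 0 - (\<Sum>i\<le>n. (v (Suc i) - v i)\<^sup>2)"
  by (induction n) (simp_all add: power2_eq_square algebra_simps)

lemma sum_second_difference_squares_le:
  fixes v :: "nat \<Rightarrow> real"
  shows "(\<Sum>i<n. (v (Suc (Suc i)) - 2 * v (Suc i) + v i)\<^sup>2) \<le> 4 * (\<Sum>i\<le>n. (v (Suc i) - v i)\<^sup>2)"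
proof -
  define D where "D i = (v (Suc i) - v i)\<^sup>2" for i
  have "(v (Suc (Suc i)) - 2 * v (Suc i) + v i)\<^sup>2 \<le> 2 * D (Suc i) + 2 * D i" for i
  proof -
    have "0 \<le> (v (Suc (Suc i)) - v i)\<^sup>2" by simp
    then show ?thesis by (simp add: D_def power2_eq_square algebra_simps)
  qed
  then have "(\<Sum>i<n. (v (Suc (Suc i)) - 2 * v (Suc i) + v i)\<^sup>2) \<le> (\<Sum>i<n. 2 * D (Suc i) + 2 * D i)"
    by (intro sum_mono)
  also have "\<dots> = 2 * (\<Sum>i<n. D (Suc i)) + 2 * (\<Sum>i<n. D i)"
    by (simp add: sum.distrib sum_distrib_left)
  also have "\<dots> \<le> 4 * (\<Sum>i\<le>n. D i)"
  proof -
    have "0 \<le> D 0" "0 \<le> D n" by (simp_all add: D_def)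
    then show ?thesis
      using sum.lessThan_Suc_shift[of D n] sum.lessThan_Suc[of D n]
      unfolding lessThan_Suc_atMost by linarith
  qed
  finally show ?thesis by (simp add: D_def)
qed

text \<open>The constants fit together: the form is at most -2/3 of the gradient energy, the
  Poincare inequality needs only 1/2 of it, and the compact operator does not increase the
  norm.\<close>

lemma compact_op_coercive:
  fixes v :: "nat \<Rightarrow> real"
  assumes "N \<ge> 1" "h = 1 / real N" "v 0 = 0" "v N = 0"
  shows "(\<Sum>i=1..N-1. second_diff h v i * compact_op h v i)
    \<le> - (\<Sum>i=1..N-1. (compact_op h v i)\<^sup>2)"
proof -
  obtain n where n: "N = Suc n" using assms(1) by (cases N) auto
  have "h = 1 / (real n + 1)" using assms n by (simp add: add.commute)
  then have h: "h > 0" "1 / h\<^sup>2 = (real n + 1)\<^sup>2" by (simp_all add: power_divide)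
  define S where "S = (\<Sum>i\<le>n. (v (Suc i) - v i)\<^sup>2)"
  define \<delta> where "\<delta> i = v (Suc (Suc i)) - 2 * v (Suc i) + v i" for i
  have sd: "second_diff h v (Suc i) = \<delta> i / h\<^sup>2" for i
    by (simp add: second_diff_def \<delta>_def)
  have co: "compact_op h v (Suc i) = (v i + 10 * v (Suc i) + v (Suc (Suc i))) / 12" for i
    using h by (simp add: compact_op_def sd \<delta>_def field_simps)
  have co': "compact_op h v (Suc i) = v (Suc i) + \<delta> i / 12" for i
    using h by (simp add: compact_op_def sd)
  have re: "(\<Sum>i=1..N-1. g i) = (\<Sum>i<n. g (Suc i))" for g :: "nat \<Rightarrow> real"
    using sum.atLeast1_atMost_eq[of g n] n by simp
  have "(\<Sum>i=1..N-1. second_diff h v i * compact_op h v i)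
      = (1 / h\<^sup>2) * ((\<Sum>i<n. \<delta> i * v (Suc i)) + (\<Sum>i<n. (\<delta> i)\<^sup>2) / 12)"
    unfolding re sd co' sum_distrib_left sum_divide_distrib sum.distrib[symmetric]
    by (intro sum.cong refl) (simp add: power2_eq_square field_simps)
  \<comment> \<open>Summation by parts contributes \<open>- S\<close>, the squared second
    differences at most \<open>4 * S / 12\<close>.\<close>
  also have "\<dots> \<le> (1 / h\<^sup>2) * (- (2 / 3) * S)"
    using sum_second_difference_times[of v n] sum_second_difference_squares_le[of v n] assms n
    by (intro mult_left_mono) (auto simp: S_def \<delta>_def)
  also have "\<dots> \<le> - ((real n + 1)\<^sup>2 / 2 * S)"
  proof -
    have "0 \<le> (real n + 1)\<^sup>2 * S" unfolding S_def by (intro mult_nonneg_nonneg sum_nonneg) auto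
    then show ?thesis unfolding h by linarith
  qed
  also have "\<dots> \<le> - (\<Sum>i=1..N-1. (compact_op h v i)\<^sup>2)"
    unfolding re co
    using sum_square_compact_le[of v n] discrete_poincare[of v n] assms n by (simp add: S_def)
  finally show ?thesis .
qed

lemma compact_op_weighted:
  "compact_op h (weighted \<sigma> y j) i
    = \<sigma> * compact_op h (\<lambda>l. y l (j + 1)) i + (1 - \<sigma>) * compact_op h (\<lambda>l. y l j) i"
  by (simp add: compact_op_def second_diff_def weighted_def add_divide_distrib
      diff_divide_distrib algebra_simps)

lemma norm0_square: "0 \<le> h \<Longrightarrow> (norm0 N h v)\<^sup>2 = (\<Sum>i=1..N-1. (v i)\<^sup>2 * h)"
  by (simp add: norm0_def sum_nonneg)

subsection \<open>Stability\<close>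

theorem theorem5p1:
  fixes \<alpha> \<sigma> T c1 c2 h \<tau> :: real
    and lam lam' lam'' k q u0 :: "real \<Rightarrow> real"
    and f :: "real \<Rightarrow> real \<Rightarrow> real"
    and N M :: nat
    and y :: "nat \<Rightarrow> nat \<Rightarrow> real"
  assumes "0 < \<alpha>" and "\<alpha> < 1" and "\<sigma> = 1 - \<alpha> / 2" and "T > 0"
    and "\<And>t. t \<in> {0..T} \<Longrightarrow> (lam has_real_derivative lam' t) (at t within {0..T})"
    and "\<And>t. t \<in> {0..T} \<Longrightarrow> (lam' has_real_derivative lam'' t) (at t within {0..T})"
    and "continuous_on {0..T} lam''"
    and "\<And>t. t \<in> {0..T} \<Longrightarrow> lam t > 0"
    and "\<And>t. t \<in> {0..T} \<Longrightarrow> lam' t \<le> 0"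
    and "c1 > 0"
    and "\<And>t. t \<in> {0..T} \<Longrightarrow> c1 \<le> k t \<and> k t \<le> c2"
    and "\<And>t. t \<in> {0..T} \<Longrightarrow> q t \<ge> 0"
    and "N \<ge> 2" and "M \<ge> 1"
    and "h = 1 / real N" and "\<tau> = T / real M"
    and "solves_compact_scheme \<alpha> \<sigma> lam k q f u0 N M h \<tau> y"
  shows "\<forall>j\<in>{0..M-1}.
    (norm0 N h (compact_op h (\<lambda>i. y i (j + 1))))\<^sup>2
      \<le> (norm0 N h (compact_op h (\<lambda>i. y i 0)))\<^sup>2
        + T powr \<alpha> * Gamma (1 - \<alpha>) / (lam T * c1)
          * Max ((\<lambda>m. (norm0 N h (compact_op h (source_grid f \<sigma> h \<tau> m)))\<^sup>2) ` {0..M-1})"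
proof -
  note \<alpha> = assms(1,2) and \<sigma>_eq = assms(3) and lam_deriv = assms(5) and lam_pos = assms(8)
    and c1 = assms(10) and N = assms(13) and h_eq = assms(15) and \<tau>_eq = assms(16)
    and scheme = assms(17)[unfolded solves_compact_scheme_def]
  have \<sigma>: "1 / 2 < \<sigma>" "\<sigma> < 1" using \<alpha> \<sigma>_eq by auto
  have h: "h > 0" and \<tau>: "\<tau> > 0" using assms by auto
  have lam_mono: "lam t \<le> lam s" if "0 \<le> s" "s \<le> t" "t \<le> T" for s t
  proof (cases "s = t")
    case False
    have "\<exists>z\<in>{s<..<t}. lam t - lam s = (\<lambda>v. lam' z * v) (t - s)"
    proof (rule mvt_simple)
      fix z assume "s \<le> z" "z \<le> t"
      then have "(lam has_real_derivative lam' z) (at z within {s..t})"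
        using lam_deriv[of z] that by (auto intro: DERIV_subset)
      then show "(lam has_derivative (\<lambda>v. lam' z * v)) (at z within {s..t})"
        by (simp add: has_field_derivative_def)
    qed (use False that in auto)
    then obtain z where "z \<in> {s<..<t}" "lam t - lam s = lam' z * (t - s)" by auto
    moreover from this have "lam' z * (t - s) \<le> 0"
      using assms(9)[of z] that by (intro mult_nonpos_nonneg) auto
    ultimately show ?thesis by simp
  qed simp

  \<comment> \<open>Energies and the claimed bound\<close>
  define w where "w n i = compact_op h (\<lambda>l. y l n) i" for n i
  define E where "E n = (norm0 N h (w n))\<^sup>2" for n
  define G where "G m = (norm0 N h (compact_op h (source_grid f \<sigma> h \<tau> m)))\<^sup>2" for m
  define F where "F = Max (G ` {0..M-1})"
  define B where "B = T powr \<alpha> * Gamma (1 - \<alpha>) / (lam T * c1) * F"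
  have lamT: "lam T > 0" using lam_pos assms(4) by auto
  have \<Gamma>: "Gamma (1 - \<alpha>) > 0" "Gamma (2 - \<alpha>) = (1 - \<alpha>) * Gamma (1 - \<alpha>)"
    using \<alpha> Gamma_real_pos[of "1 - \<alpha>"] Gamma_plus1[of "1 - \<alpha>"] nonpos_Ints_nonpos[of "1 - \<alpha>"]
    by auto
  have "0 \<le> G 0" by (simp add: G_def)
  also have "G 0 \<le> F" unfolding F_def by (intro Max_ge) auto
  finally have F0: "0 \<le> F" .
  have B0: "0 \<le> B" using F0 \<Gamma> lamT c1 by (simp add: B_def)
  \<comment> \<open>The derivative has memory, so the bound is assumed at all levels up to
    \<open>j\<close>.\<close>
  have step: "E (j + 1) \<le> E 0 + B" if "j < M" and prev: "\<And>s. s \<le> j \<Longrightarrow> E s \<le> E 0 + B" for j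
  proof -
    have "real j + 1 \<le> real M" using that(1) by linarith
    then have "(real j + \<sigma>) * \<tau> \<le> real M * \<tau>" using \<sigma> \<tau> by (intro mult_right_mono) auto
    also have "\<dots> = T" using \<tau>_eq assms(14) by simp
    finally have tj: "(real j + \<sigma>) * \<tau> \<le> T" .
    define t where "t = (real j + \<sigma>) * \<tau>"
    have t: "t \<in> {0..T}" using tj \<sigma> \<tau> by (simp add: t_def)
    define c where "c = coeff_c \<alpha> \<sigma> lam \<tau> j"
    \<comment> \<open>Indexing by time level turns decreasing coefficients into increasing weights:
      \<open>ks j\<close> is \<open>c 0\<close> and \<open>ks 0\<close> is
      \<open>c j\<close>.\<close>
    define ks where "ks s = c (j - s)" for s
    have lp: "0 < lam s" if "0 \<le> s" "s \<le> T" for s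
      using lam_pos that by simp
    note coeff = \<alpha> \<sigma>_eq \<tau> lp lam_mono tj
    have mono: "ks s \<le> ks (Suc s)" if "s < j" for s
      unfolding ks_def c_def using coeff_c_Suc_le[where lam = lam and s = "j - Suc s", OF coeff] that
      by (simp add: Suc_diff_Suc)
    have last: "\<sigma> * ks (j - 1) \<le> (2 * \<sigma> - 1) * ks j" if "1 \<le> j"
      unfolding ks_def c_def using coeff_c_1_le[where lam = lam, OF coeff that] that by simp
    have pos: "0 < ks j"
      unfolding ks_def c_def using coeff_c_0_pos[where lam = lam, OF coeff] by simp
    have first: "lam T * ((1 - \<alpha>) / 2 * (real j + \<sigma>) powr - \<alpha>) \<le> ks 0"
      unfolding ks_def c_def using coeff_c_last_ge[where lam = lam, OF coeff] by simp
    have first0: "0 \<le> ks 0"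
      using lamT \<alpha> by (intro order_trans[OF _ first]) auto
    define u where "u = compact_op h (weighted \<sigma> y j)"
    define \<phi> where "\<phi> = compact_op h (source_grid f \<sigma> h \<tau> j)"
    define C where "C = \<tau> powr (1 - \<alpha>) / Gamma (2 - \<alpha>) / \<tau>"
    have C: "C > 0" using \<tau> \<Gamma> \<alpha> by (simp add: C_def)
    have eq: "C * (\<Sum>s=0..j. ks s * (w (s + 1) i - w s i))
        = k t * second_diff h (weighted \<sigma> y j) i - q t * u i + \<phi> i" if "i \<in> {1..N-1}" for i
    proof -
      have "discrete_frac_deriv \<alpha> \<sigma> lam \<tau> j (\<lambda>n. w n i)
          = k t * second_diff h (weighted \<sigma> y j) i - q t * u i + \<phi> i"
        using scheme that \<open>j < M\<close> unfolding w_def t_def u_def \<phi>_def by blast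
      moreover have "discrete_frac_deriv \<alpha> \<sigma> lam \<tau> j (\<lambda>n. w n i)
          = C * (\<Sum>s=0..j. ks s * (w (s + 1) i - w s i))"
        by (simp add: discrete_frac_deriv_def C_def ks_def c_def sum_divide_distrib[symmetric])
      ultimately show ?thesis by simp
    qed
    have energy: "(\<Sum>s=0..j. ks s * ((w (s + 1) i)\<^sup>2 - (w s i)\<^sup>2))
        \<le> 2 * (\<Sum>s=0..j. ks s * (w (s + 1) i - w s i)) * u i" for i
      using discrete_energy_inequality[of j ks \<sigma> "\<lambda>s. w s i"] mono first0 \<sigma> last
      by (simp add: u_def w_def compact_op_weighted)
    \<comment> \<open>Exchanging the sums over time and space makes the energy inequality applicable
      at each grid point.\<close>
    have "C * (\<Sum>s=0..j. ks s * (E (s + 1) - E s))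
        = (\<Sum>i=1..N-1. C * (\<Sum>s=0..j. ks s * ((w (s + 1) i)\<^sup>2 - (w s i)\<^sup>2)) * h)"
    proof -
      have "E (s + 1) - E s = (\<Sum>i=1..N-1. ((w (s + 1) i)\<^sup>2 - (w s i)\<^sup>2) * h)" for s
        unfolding E_def norm0_square[OF less_imp_le[OF h]] sum_subtractf[symmetric]
        by (simp add: left_diff_distrib)
      then show ?thesis
        unfolding sum_distrib_left sum_distrib_right
        by (subst sum.swap) (simp add: sum_distrib_left mult.assoc)
    qed
    also have "\<dots> \<le> (\<Sum>i=1..N-1. 2 * (k t * second_diff h (weighted \<sigma> y j) i * u i
        - q t * (u i)\<^sup>2 + \<phi> i * u i) * h)"
    proof (intro sum_mono mult_right_mono)
      fix i assume i: "i \<in> {1..N-1}"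
      have "C * (\<Sum>s=0..j. ks s * ((w (s + 1) i)\<^sup>2 - (w s i)\<^sup>2))
          \<le> C * (2 * (\<Sum>s=0..j. ks s * (w (s + 1) i - w s i)) * u i)"
        using C by (intro mult_left_mono energy) simp
      also have "\<dots> = 2 * (C * (\<Sum>s=0..j. ks s * (w (s + 1) i - w s i))) * u i" by simp
      also have "\<dots> = 2 * (k t * second_diff h (weighted \<sigma> y j) i * u i
          - q t * (u i)\<^sup>2 + \<phi> i * u i)"
        unfolding eq[OF i] by (simp add: power2_eq_square algebra_simps)
      finally show "C * (\<Sum>s=0..j. ks s * ((w (s + 1) i)\<^sup>2 - (w s i)\<^sup>2)) \<le> \<dots>" .
    qed (use h in simp)
    \<comment> \<open>Young's inequality with weight \<open>c1\<close>, exactly what coercivity can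
      absorb below.\<close>
    also have "\<dots> \<le> (\<Sum>i=1..N-1. 2 * (k t * second_diff h (weighted \<sigma> y j) i * u i
        + c1 * (u i)\<^sup>2 + (\<phi> i)\<^sup>2 / (4 * c1)) * h)"
    proof (intro sum_mono mult_right_mono mult_left_mono)
      fix i
      have "0 \<le> (2 * c1 * u i - \<phi> i)\<^sup>2 / (4 * c1)" using c1 by simp
      also have "\<dots> = c1 * (u i)\<^sup>2 + (\<phi> i)\<^sup>2 / (4 * c1) - \<phi> i * u i"
        using c1 by (simp add: power2_eq_square field_simps)
      finally have "\<phi> i * u i \<le> c1 * (u i)\<^sup>2 + (\<phi> i)\<^sup>2 / (4 * c1)" by simp
      moreover have "0 \<le> q t * (u i)\<^sup>2" using assms(12) t by simp
      ultimately show "k t * second_diff h (weighted \<sigma> y j) i * u i - q t * (u i)\<^sup>2 + \<phi> i * u i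
          \<le> k t * second_diff h (weighted \<sigma> y j) i * u i + c1 * (u i)\<^sup>2 + (\<phi> i)\<^sup>2 / (4 * c1)"
        by simp
    qed (use h in auto)
    also have "\<dots> = 2 * h * (k t * (\<Sum>i=1..N-1. second_diff h (weighted \<sigma> y j) i * u i)
        + c1 * (\<Sum>i=1..N-1. (u i)\<^sup>2)) + G j / (2 * c1)"
      unfolding G_def norm0_square[OF less_imp_le[OF h]] \<phi>_def[symmetric]
      by (simp add: sum.distrib sum_distrib_left sum_distrib_right sum_divide_distrib algebra_simps)
    also have "\<dots> \<le> F / (2 * c1)"
    proof -
      have "weighted \<sigma> y j 0 = 0" "weighted \<sigma> y j N = 0"
        using scheme \<open>j < M\<close> by (auto simp: weighted_def)
      then have "(\<Sum>i=1..N-1. second_diff h (weighted \<sigma> y j) i * u i) \<le> - (\<Sum>i=1..N-1. (u i)\<^sup>2)"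
        unfolding u_def using N h_eq by (intro compact_op_coercive) auto
      then have "k t * (\<Sum>i=1..N-1. second_diff h (weighted \<sigma> y j) i * u i)
          \<le> k t * - (\<Sum>i=1..N-1. (u i)\<^sup>2)"
        using assms(11)[OF t] c1 by (intro mult_left_mono) auto
      also have "\<dots> \<le> c1 * - (\<Sum>i=1..N-1. (u i)\<^sup>2)"
        using assms(11)[OF t] by (intro mult_right_mono_neg) (auto intro: sum_nonneg)
      finally have "2 * h * (k t * (\<Sum>i=1..N-1. second_diff h (weighted \<sigma> y j) i * u i)
          + c1 * (\<Sum>i=1..N-1. (u i)\<^sup>2)) \<le> 0"
        using h by (intro mult_nonneg_nonpos) auto
      moreover have "G j \<le> F" unfolding F_def using \<open>j < M\<close> by (intro Max_ge) auto
      then have "G j / (2 * c1) \<le> F / (2 * c1)" using c1 by (simp add: divide_right_mono)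
      ultimately show ?thesis by simp
    qed
    finally have "C * (\<Sum>s=0..j. ks s * (E (s + 1) - E s)) \<le> F / (2 * c1)" .
    \<comment> \<open>With the lower bound for \<open>ks 0\<close>, the right side is at least
      \<open>(T / t) powr \<alpha> * (F / (2 * c1))\<close>, and \<open>t \<le> T\<close>.\<close>
    also have "\<dots> \<le> C * (ks 0 * B)"
    proof -
      have "1 \<le> (T / t) powr \<alpha>"
        using t \<sigma> \<tau> \<alpha> by (intro ge_one_powr_ge_zero) (auto simp: t_def)
      then have "F / (2 * c1) \<le> (T / t) powr \<alpha> * (F / (2 * c1))"
        using F0 c1 mult_right_mono[of 1 "(T / t) powr \<alpha>" "F / (2 * c1)"] by simp
      also have "\<dots> = C * (lam T * ((1 - \<alpha>) / 2 * (real j + \<sigma>) powr - \<alpha>) * B)"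
      proof -
        have "\<tau> powr (1 - \<alpha>) / Gamma (2 - \<alpha>) / \<tau> = 1 / (\<tau> powr \<alpha> * ((1 - \<alpha>) * Gamma (1 - \<alpha>)))"
          using \<tau> powr_diff[of \<tau> 1 \<alpha>] \<Gamma>(2) by simp
        moreover have "(T / t) powr \<alpha> = T powr \<alpha> / ((real j + \<sigma>) powr \<alpha> * \<tau> powr \<alpha>)"
          using assms(4) \<tau> \<sigma> by (simp add: t_def powr_divide powr_mult)
        \<comment> \<open>\<open>X\<close>, \<open>J\<close>, \<open>A\<close> stand for the powers
          of \<open>T\<close>, \<open>j + \<sigma>\<close>, \<open>\<tau>\<close>, and
          \<open>p\<close>, \<open>g\<close>, \<open>l\<close> for \<open>1 - \<alpha>\<close>,
          \<open>Gamma (1 - \<alpha>)\<close>, \<open>lam T\<close>. If \<open>J\<close> or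
          \<open>A\<close> is 0, both sides vanish.\<close>
        moreover have "X / (J * A) * (F / (2 * c1))
            = 1 / (A * (p * g)) * (l * (p / 2 * inverse J) * (X * g / (l * c1) * F))"
          if "p \<noteq> 0" "g \<noteq> 0" "l \<noteq> 0" for X J A p g l :: real
          using that by (simp add: divide_simps)
        moreover have "Gamma (1 - \<alpha>) \<noteq> 0" using \<Gamma>(1) by simp
        ultimately show ?thesis
          using \<alpha> lamT unfolding C_def B_def powr_minus by simp
      qed
      also have "\<dots> \<le> C * (ks 0 * B)"
        using C first B0 by (intro mult_left_mono mult_right_mono) auto
      finally show ?thesis .
    qed
    finally have "(\<Sum>s=0..j. ks s * (E (s + 1) - E s)) \<le> ks 0 * B"
      using C by simp
    then show ?thesis
      using mono pos prev by (intro discrete_gronwall_step[of j ks])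
  qed
  have "E n \<le> E 0 + B" if "n \<le> M" for n
    using that
  proof (induction n rule: less_induct)
    case (less n)
    show ?case
    proof (cases n)
      case 0
      then show ?thesis using B0 by simp
    next
      case (Suc j)
      then show ?thesis using step[of j] less by simp
    qed
  qed
  then show ?thesis
    using assms(14) unfolding E_def B_def F_def G_def w_def by auto
qed

end
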